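(* Let $(X,d)$ be a finite nonempty ultrametric space. The following conditions are equivalent. (i) $X\in\mathfrak{U}$, i.e. $|\operatorname{Sp}(X)|=|X|$. (ii) All elements of the path spectrum $\mathcal{PS}(P)$ are different for every minimum spanning path $P\in\mathfrak{P}_{min}(X)$.
   Context: An ultrametric space $(X,d)$ is a metric space with $d(x,y)\le\max\{d(x,z),d(z,y)\}$ for all $x,y,z$. Its spectrum is $\operatorname{Sp}(X)=\{d(x,y):x,y\in X\}$ (so $0\in\operatorname{Sp}(X)$). $\mathfrak{U}$ denotes the class of finite ultrametric spaces $X$ with $|\operatorname{Sp}(X)|=|X|$. Minimum spanning paths: a finite metric space $(X,d)$ is regarded as the complete weighted graph $(G_X,w)$ with $V(G_X)=X$ and $w(\{x,y\})=d(x,y)$ for $x\ne y$. A minimum spanning tree of $(X,d)$ is a spanning tree of $G_X$ whose sum of edge weights is smallest among all spanning trees. $\mathfrak{P}_{min}(X)$ is the set of all minimum spanning paths, i.e. minimum spanning trees that are paths (a path is a nonempty graph with vertices $x_1,\dots,x_n$ and edges exactly $\{x_1,x_2\},\dots,\{x_{n-1},x_n\}$; a single vertex is allowed). For $P\in\mathfrak{P}_{min}(X)$ with vertices numbered $x_1,\dots,x_n$ along $P$, $n=|X|$, the path spectrum is the finite sequence $\mathcal{PS}(P)=(s_1,\dots,s_{n-1})$, $s_i=d(x_i,x_{i+1})$; "all elements are different" means $s_i\ne s_j$ for $i\ne j$. *)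

theory Defs
  imports "HOL-Analysis.Analysis"
begin

section \<open>Ultrametric spaces and their spectrum\<close>

locale Ultrametric_space = Metric_space M d for M :: "'a set" and d :: "'a \<Rightarrow> 'a \<Rightarrow> real" +
  assumes ultrametric:
    "\<And>x y z. \<lbrakk>x \<in> M; y \<in> M; z \<in> M\<rbrakk> \<Longrightarrow> d x y \<le> max (d x z) (d z y)"

definition spectrum :: "'a set \<Rightarrow> ('a \<Rightarrow> 'a \<Rightarrow> real) \<Rightarrow> real set" where
  "spectrum M d = {d x y | x y. x \<in> M \<and> y \<in> M}"

definition class_U :: "'a set \<Rightarrow> ('a \<Rightarrow> 'a \<Rightarrow> real) \<Rightarrow> bool" where
  "class_U M d \<longleftrightarrow> Ultrametric_space M d \<and> finite M \<and> card (spectrum M d) = card M"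

section \<open>Simple undirected graphs\<close>

type_synonym 'a ugraph = "'a set \<times> 'a set set"

abbreviation uverts :: "'a ugraph \<Rightarrow> 'a set" where "uverts \<equiv> fst"
abbreviation uedges :: "'a ugraph \<Rightarrow> 'a set set" where "uedges \<equiv> snd"

definition complete_graph :: "'a set \<Rightarrow> 'a ugraph" where
  "complete_graph V = (V, {{x, y} | x y. x \<in> V \<and> y \<in> V \<and> x \<noteq> y})"

definition simple_graph :: "'a ugraph \<Rightarrow> bool" where
  "simple_graph G \<longleftrightarrow> uedges G \<subseteq> uedges (complete_graph (uverts G))"

definition is_subgraph :: "'a ugraph \<Rightarrow> 'a ugraph \<Rightarrow> bool" where
  "is_subgraph H G \<longleftrightarrow>
     simple_graph H \<and> simple_graph G \<and> uverts H \<subseteq> uverts G \<and> uedges H \<subseteq> uedges G"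

text \<open>
  \<open>numbering xs P\<close>: the graph \<open>P\<close> is a path and \<open>xs\<close> lists its vertices in their order along \<open>P\<close>.
  A path with at least two vertices has exactly two numberings, each the reversal of the other.
\<close>
definition numbering :: "'a list \<Rightarrow> 'a ugraph \<Rightarrow> bool" where
  "numbering xs P \<longleftrightarrow> xs \<noteq> [] \<and> distinct xs \<and> uverts P = set xs \<and>
     uedges P = {{xs ! i, xs ! Suc i} | i. Suc i < length xs}"

definition path_graph :: "'a ugraph \<Rightarrow> bool" where
  "path_graph P \<longleftrightarrow> (\<exists>xs. numbering xs P)"

definition cycle_graph :: "'a ugraph \<Rightarrow> bool" where
  "cycle_graph C \<longleftrightarrow> (\<exists>xs. length xs \<ge> 3 \<and> distinct xs \<and> uverts C = set xs \<and>
     uedges C = {{xs ! i, xs ! (Suc i mod length xs)} | i. i < length xs})"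

definition connected_graph :: "'a ugraph \<Rightarrow> bool" where
  "connected_graph G \<longleftrightarrow> (\<forall>u\<in>uverts G. \<forall>v\<in>uverts G.
     \<exists>P xs. is_subgraph P G \<and> numbering xs P \<and> hd xs = u \<and> last xs = v)"

definition tree_graph :: "'a ugraph \<Rightarrow> bool" where
  "tree_graph T \<longleftrightarrow> simple_graph T \<and> uverts T \<noteq> {} \<and> connected_graph T \<and>
     \<not> (\<exists>C. is_subgraph C T \<and> cycle_graph C)"

definition is_spanning_tree :: "'a ugraph \<Rightarrow> 'a ugraph \<Rightarrow> bool" where
  "is_spanning_tree T G \<longleftrightarrow> is_subgraph T G \<and> uverts T = uverts G \<and> tree_graph T"

definition total_weight :: "('a set \<Rightarrow> real) \<Rightarrow> 'a ugraph \<Rightarrow> real" where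
  "total_weight w G = (\<Sum>e\<in>uedges G. w e)"

definition is_min_spanning_tree :: "('a set \<Rightarrow> real) \<Rightarrow> 'a ugraph \<Rightarrow> 'a ugraph \<Rightarrow> bool" where
  "is_min_spanning_tree w T G \<longleftrightarrow> is_spanning_tree T G \<and>
     (\<forall>T'. is_spanning_tree T' G \<longrightarrow> total_weight w T \<le> total_weight w T')"

section \<open>Minimum spanning paths of a metric space\<close>

text \<open>The description is unique because \<open>d\<close> is symmetric; see \<open>dist_weight_eq\<close> below.\<close>
definition dist_weight :: "('a \<Rightarrow> 'a \<Rightarrow> real) \<Rightarrow> 'a set \<Rightarrow> real" where
  "dist_weight d e = (THE r. \<exists>x y. e = {x, y} \<and> x \<noteq> y \<and> r = d x y)"

lemma (in Metric_space) dist_weight_eq: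
  assumes "x \<noteq> y"
  shows "dist_weight d {x, y} = d x y"
  unfolding dist_weight_def
  by (rule the_equality) (use assms in \<open>auto simp: doubleton_eq_iff commute\<close>)

definition min_spanning_paths :: "'a set \<Rightarrow> ('a \<Rightarrow> 'a \<Rightarrow> real) \<Rightarrow> 'a ugraph set" where
  "min_spanning_paths M d =
     {P. is_min_spanning_tree (dist_weight d) P (complete_graph M) \<and> path_graph P}"

text \<open>
  The path spectrum is a sequence rather than a set, and it is attached to a numbering of the path:
  reversing the numbering reverses the sequence.
\<close>
definition path_spectrum :: "('a \<Rightarrow> 'a \<Rightarrow> real) \<Rightarrow> 'a list \<Rightarrow> real list" where
  "path_spectrum d xs = map (\<lambda>i. d (xs ! i) (xs ! Suc i)) [0..<length xs - 1]"

end

theory Submission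
  imports Defs
begin

text \<open>
  Order \<open>X\<close> greedily, each point being followed by one of the nearest points not yet listed. The gaps
  \<open>s\<^sub>1, \<dots>, s\<^sub>n\<^sub>-\<^sub>1\<close> of this ordering carry both sides of the equivalence.
  
  By the ultrametric inequality, the gaps and \<open>0\<close> exhaust the spectrum
  (\<open>spectrum_nearest_neighbour_list\<close>): triangles are isosceles, and the first point of the list is at
  least as far from every later point as from its successor. Hence \<open>|Sp(X)| = |X|\<close> says exactly that
  the \<open>n - 1\<close> gaps of the greedy path are different.
  
  It remains to see that every minimum spanning path has the same gaps as the greedy one, as
  multisets, and that the greedy path is a minimum spanning path itself. Fix \<open>r > 0\<close>. The points at
  mutual distance less than \<open>r\<close> form the classes of an equivalence relation; to link \<open>c\<close> classes, a
  connected graph on \<open>X\<close> needs at least \<open>c - 1\<close> edges of weight at least \<open>r\<close>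
  (\<open>separated_card_le_heavy_edges\<close>). The greedy path attains this bound
  (\<open>nearest_neighbour_list_separated\<close>). So, for every threshold \<open>r\<close> at once, it has at most as many
  edges of weight at least \<open>r\<close> as any other spanning tree \<open>T\<close>. Such a domination between multisets of
  positive numbers gives an inequality between the sums, and equality of the multisets if the sums
  agree (\<open>multiset_domination\<close>). The inequality makes the greedy path minimal; the case of equality
  identifies its weights with those of every other minimum spanning tree.
\<close>

section \<open>Domination of multisets of reals\<close>

text \<open>
  Sort both multisets in descending order: the hypothesis on the thresholds says that the \<open>k\<close>-th
  largest element of \<open>A\<close> is at most the \<open>k\<close>-th largest element of \<open>B\<close>. The induction avoids sorting by
  removing a largest element of \<open>A\<close> together with some element of \<open>B\<close> that is at least as large.
  Positivity of \<open>B\<close> matters when \<open>A\<close> is used up: equal sums then leave nothing of \<open>B\<close>.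
\<close>
lemma multiset_domination:
  fixes A B :: "real multiset"
  assumes "\<And>a. a \<in># A \<Longrightarrow> 0 < a" and "\<And>b. b \<in># B \<Longrightarrow> 0 < b"
    and "\<And>r. 0 < r \<Longrightarrow> size {#a \<in># A. r \<le> a#} \<le> size {#b \<in># B. r \<le> b#}"
  shows "sum_mset A \<le> sum_mset B" and "sum_mset A = sum_mset B \<Longrightarrow> A = B"
proof -
  have "sum_mset A \<le> sum_mset B \<and> (sum_mset A = sum_mset B \<longrightarrow> A = B)"
    using assms
  proof (induction "size A" arbitrary: A B)
    case 0
    then have A: "A = {#}" by simp
    have nonneg: "0 \<le> sum_mset C" if "\<And>b. b \<in># C \<Longrightarrow> 0 < b" for C :: "real multiset"
      using that by (induction C) (simp, simp add: order.strict_implies_order)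
    have "B = {#}" if "sum_mset B = 0"
    proof (rule ccontr)
      assume "B \<noteq> {#}"
      then obtain b B' where B: "B = add_mset b B'" by (meson multiset_cases)
      have "0 < b" "0 \<le> sum_mset B'" using B 0(3) by (auto intro!: nonneg)
      then show False using that B by simp
    qed
    then show ?case using A nonneg[of B] 0(3) by auto
  next
    case (Suc n)
    then have ne: "A \<noteq> {#}" by auto
    define a where "a = Max (set_mset A)"
    have aA: "a \<in># A" and amax: "\<And>x. x \<in># A \<Longrightarrow> x \<le> a"
      using ne by (auto simp: a_def)
    have a0: "0 < a" using Suc.prems(1) aA by blast
    have "0 < size {#x \<in># A. a \<le> x#}"
      using aA by (auto simp: size_eq_0_iff_empty nonempty_has_size[symmetric] filter_mset_eq_mempty_iff)
    then have "0 < size {#b \<in># B. a \<le> b#}" using Suc.prems(3)[OF a0] by linarith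
    then obtain b where b: "b \<in># B" "a \<le> b"
      by (auto simp: nonempty_has_size[symmetric] filter_mset_eq_mempty_iff)
    obtain A' where A': "A = add_mset a A'" using aA by (meson multi_member_split)
    obtain B' where B': "B = add_mset b B'" using b by (meson multi_member_split)
    have "size {#x \<in># A'. r \<le> x#} \<le> size {#x \<in># B'. r \<le> x#}" if "0 < r" for r
    proof (cases "r \<le> a")
      case True
      then show ?thesis using Suc.prems(3)[OF that] b A' B' by simp
    next
      case False
      then have "{#x \<in># A'. r \<le> x#} = {#}"
        using amax A' by (force simp: filter_mset_eq_mempty_iff)
      then show ?thesis by (metis le0 size_empty)
    qed
    then have "sum_mset A' \<le> sum_mset B' \<and> (sum_mset A' = sum_mset B' \<longrightarrow> A' = B')"
      using Suc.hyps(2) Suc.prems(1,2) A' B' by (intro Suc.hyps(1)) auto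
    then show ?case using A' B' b by auto
  qed
  then show "sum_mset A \<le> sum_mset B" and "sum_mset A = sum_mset B \<Longrightarrow> A = B"
    by auto
qed

section \<open>Paths as graphs\<close>

definition path_edges :: "'a list \<Rightarrow> 'a set set" where
  "path_edges xs = {{xs ! i, xs ! Suc i} | i. Suc i < length xs}"

lemma numbering_iff: "numbering xs P \<longleftrightarrow> xs \<noteq> [] \<and> distinct xs \<and> P = (set xs, path_edges xs)"
  by (cases P) (auto simp: numbering_def path_edges_def)

text \<open>
  Describing an edge by the part of the list before and after it, instead of by an index, makes
  reversal and passage to a sublist immediate.
\<close>
lemma path_edges_split: "path_edges xs = {{a, b} | a b. \<exists>us vs. xs = us @ a # b # vs}"
proof -
  have "\<exists>us vs. xs = us @ xs ! i # xs ! Suc i # vs" if "Suc i < length xs" for i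
    using id_take_nth_drop[of i xs] Cons_nth_drop_Suc[of "Suc i" xs] that
    by (metis Suc_lessD)
  moreover have "\<exists>i. {a, b} = {xs ! i, xs ! Suc i} \<and> Suc i < length xs"
    if "xs = us @ a # b # vs" for us a b vs
    using that by (intro exI[of _ "length us"]) (auto simp: nth_append)
  ultimately have "e \<in> path_edges xs \<longleftrightarrow> e \<in> {{a, b} | a b. \<exists>us vs. xs = us @ a # b # vs}" for e
    unfolding path_edges_def mem_Collect_eq by metis
  then show ?thesis by blast
qed

lemma path_edges_rev: "path_edges (rev xs) = path_edges xs"
proof -
  have "path_edges xs \<subseteq> path_edges (rev xs)" for xs :: "'b list"
  proof
    fix e assume "e \<in> path_edges xs"
    then obtain us a b vs where e: "e = {a, b}" "xs = us @ a # b # vs"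
      by (auto simp: path_edges_split)
    then have "rev xs = rev vs @ b # a # rev us" by simp
    then show "e \<in> path_edges (rev xs)" using e unfolding path_edges_split by blast
  qed
  from this[of xs] this[of "rev xs"] show ?thesis by auto
qed

lemma path_edges_infix: "path_edges ys \<subseteq> path_edges (us @ ys @ vs)"
proof
  fix e assume "e \<in> path_edges ys"
  then obtain as a b bs where "e = {a, b}" "ys = as @ a # b # bs"
    unfolding path_edges_split by blast
  then have "us @ ys @ vs = (us @ as) @ a # b # (bs @ vs)" "e = {a, b}" by simp_all
  then show "e \<in> path_edges (us @ ys @ vs)" unfolding path_edges_split by blast
qed

lemma simple_graph_path: "distinct xs \<Longrightarrow> simple_graph (set xs, path_edges xs)"
  by (fastforce simp: simple_graph_def complete_graph_def path_edges_def nth_eq_iff_index_eq)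

lemma connected_graph_path:
  assumes "distinct xs"
  shows "connected_graph (set xs, path_edges xs)"
proof -
  let ?ok = "\<lambda>u v. \<exists>P zs. is_subgraph P (set xs, path_edges xs) \<and> numbering zs P
    \<and> hd zs = u \<and> last zs = v"
  have infix_ok: "?ok (hd zs) (last zs)" "?ok (last zs) (hd zs)"
    if "xs = us @ zs @ vs" "zs \<noteq> []" for us zs vs
  proof -
    have sub: "is_subgraph (set zs, path_edges zs) (set xs, path_edges xs)"
      using that assms path_edges_infix[of zs us vs] simple_graph_path[of zs]
        simple_graph_path[OF assms]
      by (auto simp: is_subgraph_def)
    have "numbering zs (set zs, path_edges zs)" "numbering (rev zs) (set zs, path_edges zs)"
      using that assms by (auto simp: numbering_iff path_edges_rev)
    then show "?ok (hd zs) (last zs)" "?ok (last zs) (hd zs)"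
      using sub that(2) by (metis, metis hd_rev last_rev)
  qed
  have "?ok u v" if u: "u \<in> set xs" and v: "v \<in> set xs" for u v
  proof -
    obtain us vs where xs: "xs = us @ u # vs" using split_list[OF u] by blast
    consider "v = u" | "v \<in> set us" | "v \<in> set vs" using v xs by auto
    then show ?thesis
    proof cases
      case 1
      then show ?thesis using infix_ok[of us "[u]" vs] xs by simp
    next
      case 2
      then obtain as bs where "us = as @ v # bs" by (blast dest: split_list)
      then show ?thesis using infix_ok(2)[of as "v # bs @ [u]" vs] xs by simp
    next
      case 3
      then obtain as bs where "vs = as @ v # bs" by (blast dest: split_list)
      then show ?thesis using infix_ok(1)[of us "u # as @ [v]" bs] xs by simp
    qed
  qed
  then show ?thesis by (auto simp: connected_graph_def)
qed

text \<open>
  Consider the vertex of a cycle that comes last along the path. Both of its neighbours on the cycle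
  would have to be its predecessor on the path, but a cycle has length at least \<open>3\<close>, so they differ.
\<close>
lemma acyclic_path:
  assumes dist: "distinct xs" and sub: "is_subgraph C (set xs, path_edges xs)"
  shows "\<not> cycle_graph C"
proof
  assume "cycle_graph C"
  then obtain cs where len: "length cs \<ge> 3" and dcs: "distinct cs" and vC: "uverts C = set cs"
    and eC: "uedges C = {{cs ! i, cs ! (Suc i mod length cs)} | i. i < length cs}"
    unfolding cycle_graph_def by blast
  let ?n = "length cs"
  have "\<forall>c\<in>set cs. \<exists>i<length xs. c = xs ! i"
    using sub vC by (force simp: is_subgraph_def in_set_conv_nth)
  then obtain pos where pos: "\<And>c. c \<in> set cs \<Longrightarrow> pos c < length xs \<and> c = xs ! pos c"
    by metis
  have step: "pos u = Suc (pos v) \<or> pos v = Suc (pos u)"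
    if "{u, v} \<in> uedges C" "u \<in> set cs" "v \<in> set cs" for u v
  proof -
    have "{u, v} \<in> path_edges xs" using that sub by (auto simp: is_subgraph_def)
    then obtain i where i: "Suc i < length xs" "{u, v} = {xs ! i, xs ! Suc i}"
      by (auto simp: path_edges_def)
    have "pos w = j" if "w \<in> set cs" "w = xs ! j" "j < length xs" for w j
      using pos[OF that(1)] that dist nth_eq_iff_index_eq by metis
    then show ?thesis using i that by (auto simp: doubleton_eq_iff)
  qed
  have "cs \<noteq> []" using len by auto
  then obtain c where c: "c \<in> set cs" and cmax: "\<And>c'. c' \<in> set cs \<Longrightarrow> pos c' \<le> pos c"
    using Max_in[of "pos ` set cs"] Max_ge[of "pos ` set cs"] by fastforce
  obtain m where m: "m < ?n" "c = cs ! m" using c by (auto simp: in_set_conv_nth)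
  \<comment> \<open>\<open>p\<close> and \<open>q\<close> are the cyclic predecessor and successor of \<open>m\<close>.\<close>
  define p where "p = (if m = 0 then ?n - 1 else m - 1)"
  define q where "q = Suc m mod ?n"
  have pq: "p < ?n" "q < ?n" "Suc p mod ?n = m" "p \<noteq> q"
    using m(1) len by (auto simp: p_def q_def mod_Suc split: if_splits)
  have "{cs ! p, c} \<in> uedges C" "{c, cs ! q} \<in> uedges C"
    using eC m pq by (auto simp: q_def)
  then have "pos c = Suc (pos (cs ! p))" "pos c = Suc (pos (cs ! q))"
    using step[of "cs ! p" c] step[of c "cs ! q"] cmax[of "cs ! p"] cmax[of "cs ! q"] c pq
    by auto
  then have "cs ! p = cs ! q" using pos[of "cs ! p"] pos[of "cs ! q"] pq by auto
  then show False using dcs pq nth_eq_iff_index_eq by blast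
qed

lemma path_is_spanning_tree:
  assumes "numbering xs P" and "set xs = V"
  shows "is_spanning_tree P (complete_graph V)"
proof -
  have xs: "xs \<noteq> []" "distinct xs" "P = (set xs, path_edges xs)"
    using assms(1) by (auto simp: numbering_iff)
  have "is_subgraph P (complete_graph V)"
    using simple_graph_path[OF xs(2)] xs(3) assms(2)
    by (auto simp: is_subgraph_def simple_graph_def complete_graph_def)
  then show ?thesis
    using xs assms(2) connected_graph_path[OF xs(2)] acyclic_path[OF xs(2)] simple_graph_path[OF xs(2)]
    unfolding is_spanning_tree_def tree_graph_def by (auto simp: complete_graph_def)
qed

text \<open>
  The only consequence of connectedness that the lower bound on weights uses.
\<close>
lemma connected_graph_cut:
  assumes "connected_graph G" and "C \<inter> uverts G \<noteq> {}" and "\<not> uverts G \<subseteq> C"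
  shows "\<exists>u v. u \<in> C \<and> v \<notin> C \<and> {u, v} \<in> uedges G"
proof -
  obtain u v where uv: "u \<in> uverts G" "v \<in> uverts G" "u \<in> C" "v \<notin> C" using assms by blast
  then obtain P xs where P: "is_subgraph P G" "numbering xs P" and ends: "hd xs = u" "last xs = v"
    using assms(1) unfolding connected_graph_def by blast
  have leave: "\<exists>us a b vs. xs = us @ a # b # vs \<and> a \<in> C \<and> b \<notin> C"
    if "xs \<noteq> []" "hd xs \<in> C" "last xs \<notin> C" for xs
    using that
  proof (induction xs rule: induct_list012)
    case (3 x y zs)
    show ?case
    proof (cases "y \<in> C")
      case True
      then obtain us a b vs where "y # zs = us @ a # b # vs" "a \<in> C" "b \<notin> C"
        using 3 by auto
      then show ?thesis by (metis append_Cons)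
    next
      case False
      then show ?thesis using 3 by (metis append_Nil list.sel(1))
    qed
  qed auto
  have "xs \<noteq> []" using P by (auto simp: numbering_iff)
  then obtain us a b vs where "xs = us @ a # b # vs" "a \<in> C" "b \<notin> C"
    using leave[of xs] ends uv by auto
  moreover from this have "{a, b} \<in> path_edges xs" unfolding path_edges_split by blast
  moreover have "path_edges xs \<subseteq> uedges G" using P by (simp add: numbering_iff is_subgraph_def)
  ultimately show ?thesis by blast
qed

section \<open>Weights of spanning trees in an ultrametric space\<close>

lemma path_spectrum_simps [simp]:
  "path_spectrum d [] = []" "path_spectrum d [x] = []"
  "path_spectrum d (x # y # zs) = d x y # path_spectrum d (y # zs)"
proof -
  have "[0..<Suc (length zs)] = 0 # map Suc [0..<length zs]"
    by (metis map_Suc_upt upt_conv_Cons zero_less_Suc)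
  then show "path_spectrum d (x # y # zs) = d x y # path_spectrum d (y # zs)"
    by (simp add: path_spectrum_def comp_def del: upt_Suc)
qed (auto simp: path_spectrum_def)

fun nearest_neighbour_list :: "('a \<Rightarrow> 'a \<Rightarrow> real) \<Rightarrow> 'a list \<Rightarrow> bool" where
  "nearest_neighbour_list d (x # y # zs) \<longleftrightarrow>
     (\<forall>z\<in>set zs. d x y \<le> d x z) \<and> nearest_neighbour_list d (y # zs)"
| "nearest_neighbour_list d _ \<longleftrightarrow> True"

lemma nearest_neighbour_list_exists:
  assumes "finite X" and "x \<in> X"
  shows "\<exists>xs. hd xs = x \<and> xs \<noteq> [] \<and> distinct xs \<and> set xs = X \<and> nearest_neighbour_list d xs"
  using assms
proof (induction "card X" arbitrary: X x)
  case 0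
  then show ?case by auto
next
  case (Suc n)
  show ?case
  proof (cases "X - {x} = {}")
    case True
    then show ?thesis using Suc.prems by (intro exI[of _ "[x]"]) auto
  next
    case False
    define y where "y = arg_min_on (d x) (X - {x})"
    have y: "y \<in> X - {x}" "\<And>z. z \<in> X - {x} \<Longrightarrow> d x y \<le> d x z"
      using False Suc.prems arg_min_if_finite[of "X - {x}" "d x"] arg_min_least[of "X - {x}" _ "d x"]
      by (auto simp: y_def)
    have "n = card (X - {x})" using Suc.hyps(2) Suc.prems by simp
    then obtain ys where ys: "hd ys = y" "ys \<noteq> []" "distinct ys" "set ys = X - {x}"
      "nearest_neighbour_list d ys"
      using Suc.hyps(1)[of "X - {x}" y] Suc.prems y by auto
    then obtain zs where "ys = y # zs" by (cases ys) auto
    then show ?thesis using ys y Suc.prems by (intro exI[of _ "x # ys"]) auto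
  qed
qed

context Ultrametric_space
begin

text \<open>
  Let \<open>x\<close> head the list, \<open>y\<close> come next and \<open>v\<close> be any later point. Since \<open>d x y \<le> d x v\<close>, the isosceles
  property of the triangle \<open>x, y, v\<close> forces \<open>d x v\<close> to be \<open>d x y\<close> or \<open>d y v\<close>, and \<open>d y v\<close> is a distance
  within the tail.
\<close>
lemma spectrum_nearest_neighbour_list:
  assumes "nearest_neighbour_list d xs" "set xs \<subseteq> M"
  shows "spectrum (set xs) d \<subseteq> insert 0 (set (path_spectrum d xs))"
  using assms
proof (induction xs rule: induct_list012)
  case (3 x y zs)
  let ?S = "insert 0 (set (path_spectrum d (x # y # zs)))"
  have IH: "spectrum (set (y # zs)) d \<subseteq> ?S" using 3 by auto
  have rest: "d u v \<in> ?S" if "u \<in> set (y # zs)" "v \<in> set (y # zs)" for u v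
    using IH that unfolding spectrum_def by blast
  have x: "d x v \<in> ?S" if v: "v \<in> set (y # zs)" for v
  proof (cases "v = y")
    case False
    then have vz: "v \<in> set zs" using v by simp
    have M: "x \<in> M" "y \<in> M" "v \<in> M" using 3(4) vz by auto
    have "d x y \<le> d x v" using 3(3) vz by auto
    then have "d x v = d x y \<or> d x v = d y v"
      using ultrametric[of x v y] ultrametric[of y v x] M commute[of x y] by linarith
    then show ?thesis using rest[of y v] v by auto
  qed auto
  show ?case
  proof
    fix t assume "t \<in> spectrum (set (x # y # zs)) d"
    then obtain u v where t: "t = d u v" and uv: "u \<in> set (x # y # zs)" "v \<in> set (x # y # zs)"
      unfolding spectrum_def by blast
    have "x \<in> M" using 3(4) by auto
    then show "t \<in> ?S"
      using t uv rest[of u v] x[of u] x[of v] commute[of u v] mdist_zero[of x] by auto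
  qed
qed (auto simp: spectrum_def)

definition separated :: "real \<Rightarrow> 'a set \<Rightarrow> bool" where
  "separated r L \<longleftrightarrow> (\<forall>u\<in>L. \<forall>v\<in>L. u \<noteq> v \<longrightarrow> r \<le> d u v)"

text \<open>
  The set \<open>L\<close> consists of the points whose gap to the next point is at least \<open>r\<close>, and the last point.
  Such a point is at distance at least \<open>r\<close> from everything after it, because its successor is nearest.
\<close>
lemma nearest_neighbour_list_separated:
  assumes "nearest_neighbour_list d xs" "distinct xs" "xs \<noteq> []"
  shows "\<exists>L\<subseteq>set xs. separated r L \<and> card L = Suc (size {#s \<in># mset (path_spectrum d xs). r \<le> s#})"
  using assms
proof (induction xs rule: induct_list012)
  case (2 x)
  then show ?case by (intro exI[of _ "{x}"]) (auto simp: separated_def)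
next
  case (3 x y zs)
  then obtain L where L: "L \<subseteq> set (y # zs)" "separated r L"
    "card L = Suc (size {#s \<in># mset (path_spectrum d (y # zs)). r \<le> s#})" by auto
  show ?case
  proof (cases "r \<le> d x y")
    case True
    have "r \<le> d x v" if "v \<in> L" for v
      using True 3(3) L(1) that by force
    moreover have "x \<notin> L" "finite L" using L(1) 3(4) by (auto intro: finite_subset)
    ultimately show ?thesis
      using L True by (intro exI[of _ "insert x L"]) (auto simp: separated_def commute)
  next
    case False
    then show ?thesis using L by (intro exI[of _ L]) auto
  qed
qed simp

text \<open>
  Start from one open ball of radius \<open>r\<close> and grow a union \<open>C\<close> of such balls until it fills the space. An
  edge leaving \<open>C\<close> has weight at least \<open>r\<close>, since \<open>C\<close> is closed under distances less than \<open>r\<close>. Adding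
  the ball around its outer end gains at least this heavy edge and, by the ultrametric inequality, at
  most one point of \<open>L\<close>.
\<close>
lemma separated_card_le_heavy_edges:
  assumes fin: "finite M" and r: "0 < r" and G: "connected_graph G" "simple_graph G" "uverts G = M"
    and L: "L \<subseteq> M" "separated r L"
  shows "card L \<le> Suc (card {e \<in> uedges G. r \<le> dist_weight d e})"
proof (cases "M = {}")
  case True
  then show ?thesis using L by simp
next
  case False
  let ?H = "\<lambda>C. {e \<in> uedges G. e \<subseteq> C \<and> r \<le> dist_weight d e}"
  let ?closed = "\<lambda>C. C \<subseteq> M \<and> (\<forall>u\<in>C. \<forall>v\<in>M. d u v < r \<longrightarrow> v \<in> C)"
  let ?B = "\<lambda>v. {z \<in> M. d v z < r}"
  have edge_sub: "uedges G \<subseteq> Pow M"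
    using G by (auto simp: simple_graph_def complete_graph_def)
  then have finE: "finite (uedges G)" using fin finite_subset by auto
  have finL: "finite L" using L fin finite_subset by auto
  have near: "d u w < r" if "d u v < r" "d v w < r" "u \<in> M" "v \<in> M" "w \<in> M" for u v w
    using ultrametric[of u w v] that by auto
  have B: "?closed (?B v)" "card (L \<inter> ?B v) \<le> 1" "v \<in> ?B v" if v: "v \<in> M" for v
  proof -
    show "?closed (?B v)" using near[of v] v by blast
    have "x = y" if "x \<in> L \<inter> ?B v" "y \<in> L \<inter> ?B v" for x y
      using near[of x v y] that v L(2) commute[of x v] by (force simp: separated_def)
    then show "card (L \<inter> ?B v) \<le> 1" using finL by (simp add: card_le_Suc0_iff_eq)
    show "v \<in> ?B v" using v r by simp
  qed
  have grow: "card L \<le> Suc (card (?H M))"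
    if "?closed C" "C \<noteq> {}" "card (L \<inter> C) \<le> Suc (card (?H C))" for C
    using that
  proof (induction "card (M - C)" arbitrary: C rule: less_induct)
    case less
    show ?case
    proof (cases "C = M")
      case True
      then show ?thesis using less.prems L by (simp add: Int_absorb2)
    next
      case False
      then obtain u v where uv: "u \<in> C" "v \<notin> C" "{u, v} \<in> uedges G"
        using connected_graph_cut[OF G(1), of C] less.prems G(3) by blast
      then have M: "u \<in> M" "v \<in> M" and ne: "u \<noteq> v" using edge_sub by auto
      have heavy: "r \<le> dist_weight d {u, v}"
        using less.prems(1) uv M dist_weight_eq[OF ne] by force
      let ?C = "C \<union> ?B v"
      have "?closed ?C" using less.prems(1) B(1)[OF M(2)] by blast
      moreover have "card (L \<inter> ?C) \<le> Suc (card (?H ?C))"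
      proof -
        have "card (L \<inter> ?C) \<le> card (L \<inter> C) + card (L \<inter> ?B v)"
          by (metis Int_Un_distrib card_Un_le)
        also have "\<dots> \<le> Suc (card (?H C)) + 1"
          using less.prems(3) B(2)[OF M(2)] by (rule add_mono)
        also have "\<dots> = Suc (card (insert {u, v} (?H C)))"
          using uv(2) finE by simp
        finally have "card (L \<inter> ?C) \<le> Suc (card (insert {u, v} (?H C)))" .
        moreover have "card (insert {u, v} (?H C)) \<le> card (?H ?C)"
        proof (rule card_mono)
          have "{u, v} \<in> ?H ?C" using uv heavy B(3)[OF M(2)] by blast
          then show "insert {u, v} (?H C) \<subseteq> ?H ?C" by blast
        qed (use finE in simp)
        ultimately show ?thesis by linarith
      qed
      moreover have "card (M - ?C) < card (M - C)"
      proof (rule psubset_card_mono)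
        show "M - ?C \<subset> M - C" using uv(2) M(2) B(3)[OF M(2)] by blast
      qed (use fin in simp)
      moreover have "?C \<noteq> {}" using uv(1) by blast
      ultimately show ?thesis by - (rule less.hyps[of ?C])
    qed
  qed
  obtain x where x: "x \<in> M" using False by blast
  have "card L \<le> Suc (card (?H M))"
    by (rule grow[OF B(1)[OF x]]) (use B(2,3)[OF x] in auto)
  moreover have "?H M = {e \<in> uedges G. r \<le> dist_weight d e}" using edge_sub by auto
  ultimately show ?thesis by simp
qed

definition edge_weights :: "'a ugraph \<Rightarrow> real multiset" where
  "edge_weights G = image_mset (dist_weight d) (mset_set (uedges G))"

lemma total_weight_eq: "total_weight (dist_weight d) G = sum_mset (edge_weights G)"
  by (simp add: total_weight_def edge_weights_def sum_unfold_sum_mset)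

lemma edge_weights_path:
  assumes "numbering xs P"
  shows "edge_weights P = mset (path_spectrum d xs)"
proof -
  have xs: "distinct xs" "uedges P = path_edges xs" using assms by (auto simp: numbering_iff)
  let ?e = "\<lambda>i. {xs ! i, xs ! Suc i}"
  have inj: "inj_on ?e {0..<length xs - 1}"
    using xs(1) by (auto simp: inj_on_def doubleton_eq_iff nth_eq_iff_index_eq)
  have "path_edges xs = ?e ` {0..<length xs - 1}" unfolding path_edges_def by force
  then have "mset_set (uedges P) = image_mset ?e (mset_set {0..<length xs - 1})"
    unfolding xs(2) image_mset_mset_set[OF inj] by (rule arg_cong)
  then have "edge_weights P = {#dist_weight d (?e i). i \<in># mset_set {0..<length xs - 1}#}"
    by (simp add: edge_weights_def multiset.map_comp comp_def)
  also have "\<dots> = {#d (xs ! i) (xs ! Suc i). i \<in># mset_set {0..<length xs - 1}#}"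
    using xs(1) by (intro image_mset_cong dist_weight_eq) (auto simp: nth_eq_iff_index_eq)
  also have "\<dots> = mset (path_spectrum d xs)"
    by (simp add: path_spectrum_def)
  finally show ?thesis .
qed

lemma edge_weights_pos:
  assumes "is_spanning_tree T (complete_graph M)" and "s \<in># edge_weights T"
  shows "0 < s"
proof -
  from assms(2) have "s \<in> dist_weight d ` uedges T"
    unfolding edge_weights_def by (cases "finite (uedges T)") auto
  then obtain e where e: "e \<in> uedges T" "s = dist_weight d e" by blast
  then obtain x y where "e = {x, y}" "x \<in> M" "y \<in> M" "x \<noteq> y"
    using assms(1) by (auto simp: is_spanning_tree_def is_subgraph_def complete_graph_def)
  then show ?thesis using e dist_weight_eq mdist_pos_eq by metis
qed

lemma nearest_neighbour_path_dominated:
  assumes fin: "finite M" and T: "is_spanning_tree T (complete_graph M)"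
    and P: "numbering xs P" "nearest_neighbour_list d xs" "set xs = M" and r: "0 < r"
  shows "size {#s \<in># edge_weights P. r \<le> s#} \<le> size {#s \<in># edge_weights T. r \<le> s#}"
proof -
  have tree: "connected_graph T" "simple_graph T" "uverts T = M"
    using T by (auto simp: is_spanning_tree_def tree_graph_def complete_graph_def)
  have "distinct xs" "xs \<noteq> []" using P by (auto simp: numbering_iff)
  then obtain L where L: "L \<subseteq> M" "separated r L"
    "card L = Suc (size {#s \<in># edge_weights P. r \<le> s#})"
    using nearest_neighbour_list_separated[OF P(2), of r] edge_weights_path[OF P(1)] P(3) by auto
  have "uedges T \<subseteq> Pow M" using tree by (auto simp: simple_graph_def complete_graph_def)
  then have finT: "finite (uedges T)" using fin finite_subset by auto
  have "size {#s \<in># edge_weights T. r \<le> s#} = card {e \<in> uedges T. r \<le> dist_weight d e}"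
    using finT by (simp add: edge_weights_def filter_mset_image_mset)
  then show ?thesis
    using separated_card_le_heavy_edges[OF fin r tree L(1,2)] L(3) by simp
qed

end

theorem proposition3p6:
  fixes X :: "'a set" and d :: "'a \<Rightarrow> 'a \<Rightarrow> real"
  assumes "Ultrametric_space X d" and "finite X" and "X \<noteq> {}"
  shows "class_U X d \<longleftrightarrow>
    (\<forall>P\<in>min_spanning_paths X d. \<forall>xs. numbering xs P \<longrightarrow> distinct (path_spectrum d xs))"
proof -
  interpret Ultrametric_space X d by fact
  obtain ys where ys: "ys \<noteq> []" "distinct ys" "set ys = X" "nearest_neighbour_list d ys"
    using nearest_neighbour_list_exists[OF assms(2)] assms(3) by blast
  define Q where "Q = (set ys, path_edges ys)"
  have Q: "numbering ys Q" using ys by (simp add: Q_def numbering_iff)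
  have treeQ: "is_spanning_tree Q (complete_graph X)" by (rule path_is_spanning_tree[OF Q ys(3)])
  note weights = multiset_domination[OF edge_weights_pos[OF treeQ] edge_weights_pos
      nearest_neighbour_path_dominated[OF assms(2) _ Q ys(4,3)]]
  have minQ: "Q \<in> min_spanning_paths X d"
    using treeQ weights(1) Q
    by (auto simp: min_spanning_paths_def is_min_spanning_tree_def total_weight_eq path_graph_def)
  have same: "distinct (path_spectrum d xs) \<longleftrightarrow> distinct (path_spectrum d ys)"
    if "P \<in> min_spanning_paths X d" "numbering xs P" for P xs
  proof -
    have treeP: "is_spanning_tree P (complete_graph X)"
      and "sum_mset (edge_weights P) \<le> sum_mset (edge_weights Q)"
      using that(1) treeQ
      unfolding min_spanning_paths_def is_min_spanning_tree_def total_weight_eq by blast+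
    then have "edge_weights Q = edge_weights P"
      using weights[of P] by (simp add: order_antisym)
    then have "mset (path_spectrum d xs) = mset (path_spectrum d ys)"
      using edge_weights_path[OF Q] edge_weights_path[OF that(2)] by simp
    then show ?thesis by (rule mset_eq_imp_distinct_iff)
  qed
  have "spectrum X d = insert 0 (set (path_spectrum d ys))"
  proof
    show "spectrum X d \<subseteq> insert 0 (set (path_spectrum d ys))"
      using spectrum_nearest_neighbour_list[OF ys(4)] ys(3) by simp
    have "d (ys ! i) (ys ! Suc i) \<in> spectrum X d" if "i < length ys - 1" for i
      unfolding spectrum_def using that ys(3) by (auto intro!: exI nth_mem)
    moreover have "0 \<in> spectrum X d"
      using assms(3) mdist_zero unfolding spectrum_def by force
    ultimately show "insert 0 (set (path_spectrum d ys)) \<subseteq> spectrum X d"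
      by (auto simp: path_spectrum_def)
  qed
  moreover have "0 \<notin> set (path_spectrum d ys)"
    using edge_weights_pos[OF treeQ, of 0] edge_weights_path[OF Q] by auto
  moreover have "card X = Suc (length (path_spectrum d ys))"
    using ys distinct_card[of ys] by (cases ys) (auto simp: path_spectrum_def)
  ultimately have "class_U X d \<longleftrightarrow> distinct (path_spectrum d ys)"
    using assms by (simp add: class_U_def card_distinct distinct_card iff_conv_conj_imp)
  then show ?thesis using same minQ Q by blast
qed

end
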